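(* If $f:A\to B$ and $g:B'\to C$ are morphisms of $\mathbf{HRAMnet}$ with $\pi\vdash B=_{\mathbb A}B'$, then $[\![f;g]\!]=[\![f]\!];[\![g]\!]$.
   Context: Port names and interfaces. Fix disjoint countably infinite sets $\mathbb A$ (port names) and $\mathbb P$ (pointer names). Polarities $L=\{O,P\}$, $O^*=P$, $P^*=O$. A port is $(l,a)\in L\times\mathbb A$. An interface is a finite set $A$ of ports with no repeated port name; $\mathrm{sup}(A)$ its port names; $A^{(O)}$, $A^{(P)}$ its $O$-/$P$-labelled ports. For disjoint supports $A\otimes B=A\cup B$; $A^*=\{(l^*,a)\mid(l,a)\in A\}$; $A\Rightarrow B=A^*\otimes B$. $\pi\vdash A_1=_{\mathbb A}A_2$ for a permutation $\pi$ of $\mathbb A$ means $\{(l,\pi(a))\mid(l,a)\in A_1\}=A_2$. Machines and nets. Data $\mathcal D=\{\emptyset\}\cup\mathbb P\cup\mathbb Z$; fixed $r_m\le r$. Engines $E=(A,P)$: interface $A$ plus a map $P$ from $\mathrm{sup}(A^{(O)})$ to code fragments over instructions $\mathtt{new},\mathtt{get},\mathtt{update},\mathtt{free},\mathtt{flip},\mathtt{set}$ (manipulating $r$ thread registers and a shared heap $\mathbb P\rightharpoonup\mathbb P\times\mathcal D$), with control $\mathtt{ifzero}$, $\mathtt{end}$, and $\mathtt{spark}\ a$ (only for $(P,a)\in A$). Engines run multiple threads; on input message $(a,\vec d)\in\mathbb A\times\mathcal D^{r_m}$ at $(O,a)\in A$ a thread running $P(a)$ with registers $\vec d$ (padded with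 $\emptyset$) starts; $\mathtt{spark}\ a$ jumps to $P(\chi(a))$ (passing the first $r_m$ registers) if $\chi(a)$ is an input port of the same engine, and otherwise terminates the thread and emits $(\chi(a),(d_0,\dots,d_{r_m-1}))$. An HRAM net $S=(\vec E,\chi,A)$ consists of engines with pairwise disjoint interface supports, external interface $A$, and a bijection $\chi:\mathrm{sup}(A^{(O)}\otimes A_{\vec E}^{(P)})\to\mathrm{sup}(A^{(P)}\otimes A_{\vec E}^{(O)})$. Emitted messages go into a pool from which engines receive; pending messages at $(P,a)\in A$ may be observably output with label $(P,(a,\vec d))$; an observable input $(O,(a,\vec d))$ at $(O,a)\in A$ adds $(\chi(a),\vec d)$ to the pool. A trace over $A$ is a finite sequence of polarised messages with port names in $\mathrm{sup}(A)$; $[\![S]\!]$ is the set of traces of observable labels performed from the initial configuration with silent steps interspersed. Morphisms and composition: a morphism $f:A\to B$ is a net with external interface $A\Rightarrow B$. For $f=(\vec E_f,\chi_f,A\Rightarrow B)$ and $g=(\vec E_g,\chi_g,B'\Rightarrow C)$ with $\pi\vdash B=_{\mathbb A}B'$, with $I_f,I_g$ the tensors of their engine interfaces, $f;g=(\vec E_f\cup\vec E_g,\chi,A\Rightarrow C)$ where for $a\in\mathrm{sup}((A^* )^{(O)}\otimes I_f^{(P)})$: $\chi(a)=\chi_f(a)$ if $\chi_f(a)\notin\mathrm{sup}(B)$ and $\chi(a)=\chi_g(\pi(\chi_f(a)))$ otherwise; for $a\in\mathrm{sup}(C^{(O)}\otimes I_g^{(P)})$: $\chi(a)=\chi_g(a)$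 if $\chi_g(a)\notin\mathrm{sup}(B')$ and $\chi(a)=\chi_f(\pi^{-1}(\chi_g(a)))$ otherwise. Trace composition: $s-X$ deletes from $s$ all messages with port name in $\mathrm{sup}(X)$; $s^{*B}$ is $s$ with the polarities of messages on ports of $B$ reversed; $\pi\cdot s$ renames port names by $\pi$. For $S_1$ a set of traces over $A\Rightarrow B$ and $S_2$ a set of traces over $B'\Rightarrow C$ with $\pi\vdash B=_{\mathbb A}B'$: $S_1;S_2=\{s-B\mid s \text{ a trace over } A\otimes B\otimes C,\ s-C\in S_1,\ (\pi\cdot s^{*B})-A\in S_2\}$.
   Formalization: Assumed in addition: f;g as printed is an HRAM net A→C (it fails to be one, and the claim fails, if e.g. χ_g links two ports of B' reached from A); π fixes the names of A and C; engine ports of f and g are disjoint from each other, those of f from B', those of g from B. *)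

theory Defs
  imports "HOL-Library.Multiset"
begin

datatype polarity = Opp | Pro

fun pol_dual :: "polarity \<Rightarrow> polarity" where
  "pol_dual Opp = Pro"
| "pol_dual Pro = Opp"

text \<open>Port names and pointer names are two separate copies of the naturals.\<close>

datatype port_name = Port_Name nat

datatype pointer_name = Pointer_Name nat

type_synonym interface = "(polarity \<times> port_name) set"

definition is_interface :: "interface \<Rightarrow> bool" where
  "is_interface A \<longleftrightarrow> finite A \<and> (\<forall>l l' a. (l, a) \<in> A \<and> (l', a) \<in> A \<longrightarrow> l = l')"

definition supp :: "interface \<Rightarrow> port_name set" where
  "supp A = snd ` A"

definition opp_ports :: "interface \<Rightarrow> interface" where
  "opp_ports A = {p \<in> A. fst p = Opp}"

definition pro_ports :: "interface \<Rightarrow> interface" where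
  "pro_ports A = {p \<in> A. fst p = Pro}"

text \<open>
  The tensor is meant for interfaces with disjoint supports only; disjointness is demanded
  by the well-formedness predicates below.
\<close>

definition tensor :: "interface \<Rightarrow> interface \<Rightarrow> interface" (infixr "\<otimes>" 70) where
  "A \<otimes> B = A \<union> B"

definition dual :: "interface \<Rightarrow> interface" where
  "dual A = (\<lambda>(l, a). (pol_dual l, a)) ` A"

definition arrow :: "interface \<Rightarrow> interface \<Rightarrow> interface" (infixr "\<Rrightarrow>" 65) where
  "A \<Rrightarrow> B = dual A \<otimes> B"

definition same_shape :: "(port_name \<Rightarrow> port_name) \<Rightarrow> interface \<Rightarrow> interface \<Rightarrow> bool" where
  "same_shape \<pi> A\<^sub>1 A\<^sub>2 \<longleftrightarrow> bij \<pi> \<and> (\<lambda>(l, a). (l, \<pi> a)) ` A\<^sub>1 = A\<^sub>2"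

datatype data = Empty | Ptr pointer_name | Num int

text \<open>
  Natural number arguments of instructions are register indices.
  \<open>New i j k\<close> is \<open>i := new j, k\<close> and \<open>Get i j k\<close> is \<open>i, j := get k\<close>.
\<close>

datatype instr =
    New nat nat nat
  | Get nat nat nat
  | Update nat nat
  | Free nat
  | Flip nat nat
  | Set nat data

datatype code =
    Instr instr code
  | If_Zero nat code code
  | Spark port_name
  | End

fun instr_regs :: "instr \<Rightarrow> nat set" where
  "instr_regs (New i j k) = {i, j, k}"
| "instr_regs (Get i j k) = {i, j, k}"
| "instr_regs (Update i j) = {i, j}"
| "instr_regs (Free i) = {i}"
| "instr_regs (Flip i j) = {i, j}"
| "instr_regs (Set i v) = {i}"

fun code_regs :: "code \<Rightarrow> nat set" where
  "code_regs (Instr I c) = instr_regs I \<union> code_regs c"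
| "code_regs (If_Zero i c\<^sub>1 c\<^sub>2) = {i} \<union> code_regs c\<^sub>1 \<union> code_regs c\<^sub>2"
| "code_regs (Spark a) = {}"
| "code_regs End = {}"

fun code_sparks :: "code \<Rightarrow> port_name set" where
  "code_sparks (Instr I c) = code_sparks c"
| "code_sparks (If_Zero i c\<^sub>1 c\<^sub>2) = code_sparks c\<^sub>1 \<union> code_sparks c\<^sub>2"
| "code_sparks (Spark a) = {a}"
| "code_sparks End = {}"

datatype engine = Engine (eifc: interface) (ecode: "port_name \<rightharpoonup> code")

text \<open>In the following, \<open>r\<close> is the number of registers and \<open>rm\<close> the message size.\<close>

definition wf_engine :: "nat \<Rightarrow> engine \<Rightarrow> bool" where
  "wf_engine r E \<longleftrightarrow>
     is_interface (eifc E) \<and>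
     dom (ecode E) = supp (opp_ports (eifc E)) \<and>
     (\<forall>c \<in> ran (ecode E).
        code_regs c \<subseteq> {..<r} \<and> code_sparks c \<subseteq> supp (pro_ports (eifc E)))"

type_synonym thread = "code \<times> data list"
type_synonym heap = "pointer_name \<rightharpoonup> pointer_name \<times> data"
type_synonym engine_config = "thread multiset \<times> heap"

type_synonym message = "port_name \<times> data list"
type_synonym label = "polarity \<times> message"

definition pad :: "nat \<Rightarrow> data list \<Rightarrow> data list" where
  "pad r d = d @ replicate (r - length d) Empty"

text \<open>
  Silent steps have the label \<open>None\<close>. An instruction that expects a pointer (to an allocated
  cell) in a register blocks its thread if there is none.
\<close>

inductive engine_step ::
  "nat \<Rightarrow> nat \<Rightarrow> (port_name \<Rightarrow> port_name) \<Rightarrow> engine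
    \<Rightarrow> engine_config \<Rightarrow> label option \<Rightarrow> engine_config \<Rightarrow> bool"
  for r rm :: nat and \<chi> :: "port_name \<Rightarrow> port_name" and E :: engine
where
  new: "d ! j = Ptr q \<Longrightarrow> p \<notin> dom h \<Longrightarrow>
    engine_step r rm \<chi> E
      (add_mset (Instr (New i j k) c, d) t, h) None
      (add_mset (c, d[i := Ptr p]) t, h(p \<mapsto> (q, d ! k)))"
| get: "d ! k = Ptr p \<Longrightarrow> h p = Some (q, v) \<Longrightarrow>
    engine_step r rm \<chi> E
      (add_mset (Instr (Get i j k) c, d) t, h) None
      (add_mset (c, d[i := Ptr q, j := v]) t, h)"
| update: "d ! i = Ptr p \<Longrightarrow> h p = Some (q, v) \<Longrightarrow>
    engine_step r rm \<chi> E
      (add_mset (Instr (Update i j) c, d) t, h) None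
      (add_mset (c, d) t, h(p \<mapsto> (q, d ! j)))"
| free: "d ! i = Ptr p \<Longrightarrow> p \<in> dom h \<Longrightarrow>
    engine_step r rm \<chi> E
      (add_mset (Instr (Free i) c, d) t, h) None
      (add_mset (c, d[i := Empty]) t, h(p := None))"
| flip: "engine_step r rm \<chi> E
      (add_mset (Instr (Flip i j) c, d) t, h) None
      (add_mset (c, d[i := d ! j, j := d ! i]) t, h)"
| set: "engine_step r rm \<chi> E
      (add_mset (Instr (Set i v) c, d) t, h) None
      (add_mset (c, d[i := v]) t, h)"
| if_zero: "d ! i = Num 0 \<Longrightarrow>
    engine_step r rm \<chi> E
      (add_mset (If_Zero i c\<^sub>1 c\<^sub>2, d) t, h) None (add_mset (c\<^sub>1, d) t, h)"
| if_nonzero: "d ! i \<noteq> Num 0 \<Longrightarrow>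
    engine_step r rm \<chi> E
      (add_mset (If_Zero i c\<^sub>1 c\<^sub>2, d) t, h) None (add_mset (c\<^sub>2, d) t, h)"
| end_thread: "engine_step r rm \<chi> E (add_mset (End, d) t, h) None (t, h)"
| spark_jump: "\<chi> a \<in> supp (opp_ports (eifc E)) \<Longrightarrow> ecode E (\<chi> a) = Some c \<Longrightarrow>
    engine_step r rm \<chi> E
      (add_mset (Spark a, d) t, h) None (add_mset (c, pad r (take rm d)) t, h)"
| spark_send: "\<chi> a \<notin> supp (opp_ports (eifc E)) \<Longrightarrow>
    engine_step r rm \<chi> E
      (add_mset (Spark a, d) t, h) (Some (Pro, (\<chi> a, take rm d))) (t, h)"
| receive: "(Opp, a) \<in> eifc E \<Longrightarrow> ecode E a = Some c \<Longrightarrow> length d = rm \<Longrightarrow>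
    engine_step r rm \<chi> E
      (t, h) (Some (Opp, (a, d))) (add_mset (c, pad r d) t, h)"

text \<open>The connection map \<open>conn\<close> is only relevant on its domain as given in \<open>wf_net\<close>.\<close>

datatype net =
  Net (engines: "engine set") (conn: "port_name \<Rightarrow> port_name") (ext: interface)

definition engine_ifc :: "net \<Rightarrow> interface" where
  "engine_ifc S = (\<Union>E \<in> engines S. eifc E)"

definition wf_net :: "nat \<Rightarrow> net \<Rightarrow> bool" where
  "wf_net r S \<longleftrightarrow>
     finite (engines S) \<and>
     (\<forall>E \<in> engines S. wf_engine r E) \<and>
     pairwise (\<lambda>E E'. supp (eifc E) \<inter> supp (eifc E') = {}) (engines S) \<and>
     is_interface (ext S) \<and>
     supp (ext S) \<inter> supp (engine_ifc S) = {} \<and>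
     bij_betw (conn S)
       (supp (opp_ports (ext S) \<otimes> pro_ports (engine_ifc S)))
       (supp (pro_ports (ext S) \<otimes> opp_ports (engine_ifc S)))"

text \<open>
  A net configuration assigns a configuration to every engine (its values outside
  \<open>engines S\<close> never change) and has a multiset of pending messages.
\<close>

type_synonym net_config = "(engine \<Rightarrow> engine_config) \<times> message multiset"

definition initial :: net_config where
  "initial = ((\<lambda>_. ({#}, Map.empty)), {#})"

inductive net_step ::
  "nat \<Rightarrow> nat \<Rightarrow> net \<Rightarrow> net_config \<Rightarrow> label option \<Rightarrow> net_config \<Rightarrow> bool"
  for r rm :: nat and S :: net
where
  silent: "E \<in> engines S \<Longrightarrow> engine_step r rm (conn S) E (k E) None k' \<Longrightarrow>
    net_step r rm S (k, m) None (k(E := k'), m)"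
| send: "E \<in> engines S \<Longrightarrow> engine_step r rm (conn S) E (k E) (Some (Pro, x)) k' \<Longrightarrow>
    net_step r rm S (k, m) None (k(E := k'), add_mset x m)"
| receive: "E \<in> engines S \<Longrightarrow> engine_step r rm (conn S) E (k E) (Some (Opp, x)) k' \<Longrightarrow>
    net_step r rm S (k, add_mset x m) None (k(E := k'), m)"
| env_input: "(Opp, a) \<in> ext S \<Longrightarrow> length d = rm \<Longrightarrow>
    net_step r rm S (k, m) (Some (Opp, (a, d))) (k, add_mset (conn S a, d) m)"
| env_output: "(Pro, a) \<in> ext S \<Longrightarrow>
    net_step r rm S (k, add_mset (a, d) m) (Some (Pro, (a, d))) (k, m)"

type_synonym trace = "label list"

inductive performs ::
  "nat \<Rightarrow> nat \<Rightarrow> net \<Rightarrow> net_config \<Rightarrow> trace \<Rightarrow> net_config \<Rightarrow> bool"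
  for r rm :: nat and S :: net
where
  stop: "performs r rm S n [] n"
| silent: "net_step r rm S n None n' \<Longrightarrow> performs r rm S n' s n'' \<Longrightarrow> performs r rm S n s n''"
| observable: "net_step r rm S n (Some l) n' \<Longrightarrow> performs r rm S n' s n'' \<Longrightarrow>
    performs r rm S n (l # s) n''"

definition net_traces :: "nat \<Rightarrow> nat \<Rightarrow> net \<Rightarrow> trace set" where
  "net_traces r rm S = {s. \<exists>n. performs r rm S initial s n}"

definition morphism :: "nat \<Rightarrow> net \<Rightarrow> interface \<Rightarrow> interface \<Rightarrow> bool" where
  "morphism r f A B \<longleftrightarrow>
     is_interface A \<and> is_interface B \<and> supp A \<inter> supp B = {} \<and>
     wf_net r f \<and> ext f = A \<Rrightarrow> B"

text \<open>
  Composition of \<open>f : A \<rightarrow> B\<close> with \<open>g : B' \<rightarrow> C\<close>, where \<open>\<pi>\<close> maps \<open>B\<close> to \<open>B'\<close>. The connection map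
  crosses the hidden interface at most once; if, say, \<open>g\<close> connects a port of \<open>B'\<close> directly to
  another port of \<open>B'\<close>, the result need not be a well-formed net.
\<close>

definition net_comp ::
  "(port_name \<Rightarrow> port_name) \<Rightarrow> interface \<Rightarrow> interface \<Rightarrow> interface \<Rightarrow> interface
    \<Rightarrow> net \<Rightarrow> net \<Rightarrow> net"
where
  "net_comp \<pi> A B B' C f g =
     Net (engines f \<union> engines g)
       (\<lambda>a.
         if a \<in> supp (opp_ports (dual A) \<otimes> pro_ports (engine_ifc f)) then
           (if conn f a \<notin> supp B then conn f a else conn g (\<pi> (conn f a)))
         else if a \<in> supp (opp_ports C \<otimes> pro_ports (engine_ifc g)) then
           (if conn g a \<notin> supp B' then conn g a else conn f (inv \<pi> (conn g a)))
         else undefined)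
       (A \<Rrightarrow> C)"

definition traces_over :: "nat \<Rightarrow> interface \<Rightarrow> trace set" where
  "traces_over rm A = {s. \<forall>(l, (a, d)) \<in> set s. a \<in> supp A \<and> length d = rm}"

definition trace_delete :: "trace \<Rightarrow> interface \<Rightarrow> trace" where
  "trace_delete s X = filter (\<lambda>(l, (a, d)). a \<notin> supp X) s"

definition trace_reverse :: "interface \<Rightarrow> trace \<Rightarrow> trace" where
  "trace_reverse B s =
     map (\<lambda>(l, (a, d)). (if a \<in> supp B then pol_dual l else l, (a, d))) s"

definition trace_rename :: "(port_name \<Rightarrow> port_name) \<Rightarrow> trace \<Rightarrow> trace" where
  "trace_rename \<pi> s = map (\<lambda>(l, (a, d)). (l, (\<pi> a, d))) s"

definition trace_comp ::
  "nat \<Rightarrow> (port_name \<Rightarrow> port_name) \<Rightarrow> interface \<Rightarrow> interface \<Rightarrow> interface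
    \<Rightarrow> trace set \<Rightarrow> trace set \<Rightarrow> trace set"
where
  "trace_comp rm \<pi> A B C S\<^sub>1 S\<^sub>2 =
     {trace_delete s B | s.
        s \<in> traces_over rm (A \<otimes> B \<otimes> C) \<and>
        trace_delete s C \<in> S\<^sub>1 \<and>
        trace_delete (trace_rename \<pi> (trace_reverse B s)) A \<in> S\<^sub>2}"

end

theory Submission
  imports Defs
begin

text \<open>
  A configuration of \<open>f;g\<close> is related to a pair of configurations of \<open>f\<close> and \<open>g\<close> if the engines
  agree and its pending messages are those of \<open>f\<close> and \<open>g\<close>, where a message pending at a hidden
  port is moved to the port at which it re-enters the other net. Under this relation a visible
  or silent step of \<open>f\<close> or \<open>g\<close> is the same step of \<open>f;g\<close>, whereas handing a message over the
  hidden interface leaves the configuration of \<open>f;g\<close> unchanged. Conversely, once all hidden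
  messages have been handed over, every step of \<open>f;g\<close> is a step of \<open>f\<close> or of \<open>g\<close>.
\<close>

section \<open>Port names, and the domain and codomain of the connection bijection\<close>

definition sources :: "net \<Rightarrow> port_name set" where
  "sources S = supp (opp_ports (ext S) \<otimes> pro_ports (engine_ifc S))"

definition targets :: "net \<Rightarrow> port_name set" where
  "targets S = supp (pro_ports (ext S) \<otimes> opp_ports (engine_ifc S))"

definition port_names :: "net \<Rightarrow> port_name set" where
  "port_names S = supp (ext S) \<union> supp (engine_ifc S)"

lemma in_supp_iff: "a \<in> supp A \<longleftrightarrow> (\<exists>l. (l, a) \<in> A)"
  by (force simp: supp_def)

lemma in_suppI: "(l, a) \<in> A \<Longrightarrow> a \<in> supp A"
  by (auto simp: in_supp_iff)

lemma in_supp_opp_ports_iff: "a \<in> supp (opp_ports A) \<longleftrightarrow> (Opp, a) \<in> A"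
  by (auto simp: in_supp_iff opp_ports_def)

lemma in_supp_pro_ports_iff: "a \<in> supp (pro_ports A) \<longleftrightarrow> (Pro, a) \<in> A"
  by (auto simp: in_supp_iff pro_ports_def)

lemma supp_tensor: "supp (A \<otimes> B) = supp A \<union> supp B"
  by (auto simp: supp_def tensor_def)

lemma in_sources_iff: "a \<in> sources S \<longleftrightarrow> (Opp, a) \<in> ext S \<or> (Pro, a) \<in> engine_ifc S"
  by (simp add: sources_def supp_tensor in_supp_opp_ports_iff in_supp_pro_ports_iff)

lemma in_targets_iff: "a \<in> targets S \<longleftrightarrow> (Pro, a) \<in> ext S \<or> (Opp, a) \<in> engine_ifc S"
  by (simp add: targets_def supp_tensor in_supp_opp_ports_iff in_supp_pro_ports_iff)

lemma sources_subset: "sources S \<subseteq> port_names S"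
  by (auto simp: port_names_def in_sources_iff in_supp_iff)

lemma targets_subset: "targets S \<subseteq> port_names S"
  by (auto simp: port_names_def in_targets_iff in_supp_iff)

lemma eifc_subset: "E \<in> engines S \<Longrightarrow> eifc E \<subseteq> engine_ifc S"
  by (auto simp: engine_ifc_def)

lemma conn_in_targets: "wf_net r S \<Longrightarrow> a \<in> sources S \<Longrightarrow> conn S a \<in> targets S"
  unfolding wf_net_def sources_def targets_def by (blast dest: bij_betw_apply)

lemma pol_dual_pol_dual [simp]: "pol_dual (pol_dual l) = l"
  by (cases l) auto

lemma dual_iff: "(l, a) \<in> dual A \<longleftrightarrow> (pol_dual l, a) \<in> A"
proof
  assume "(pol_dual l, a) \<in> A"
  then show "(l, a) \<in> dual A"
    unfolding dual_def by (rule rev_image_eqI) simp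
qed (auto simp: dual_def)

lemma supp_dual [simp]: "supp (dual A) = supp A"
  by (auto simp: supp_def dual_def image_image case_prod_unfold)

section \<open>Reachable configurations\<close>

text \<open>Disjoint supports do not stop an engine with empty interface from occurring in both nets
  of a composition. The second conjunct records that such an engine stays in its initial state. The
  register count ensures that emitted messages have size \<open>rm\<close>.\<close>

definition valid_engine :: "nat \<Rightarrow> engine \<Rightarrow> engine_config \<Rightarrow> bool" where
  "valid_engine r E e \<longleftrightarrow>
     (\<forall>(c, d) \<in># fst e. code_sparks c \<subseteq> supp (pro_ports (eifc E)) \<and> length d = r) \<and>
     (eifc E = {} \<longrightarrow> e = ({#}, Map.empty))"

definition valid :: "nat \<Rightarrow> nat \<Rightarrow> net \<Rightarrow> net_config \<Rightarrow> bool" where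
  "valid r rm S n \<longleftrightarrow>
     (\<forall>E \<in> engines S. valid_engine r E (fst n E)) \<and>
     (\<forall>(a, d) \<in># snd n. a \<in> targets S \<and> length d = rm)"

lemma length_pad: "length d \<le> r \<Longrightarrow> length (pad r d) = r"
  by (simp add: pad_def)

lemma wf_engine_code_sparks:
  "wf_engine r E \<Longrightarrow> ecode E a = Some c \<Longrightarrow> code_sparks c \<subseteq> supp (pro_ports (eifc E))"
  by (auto simp: wf_engine_def ran_def)

text \<open>With an empty interface there is no thread to run, and \<open>receive\<close> needs an
  input port.\<close>

lemma engine_step_eifc_nonempty:
  "engine_step r rm \<chi> E e l e' \<Longrightarrow> valid_engine r E e \<Longrightarrow> eifc E \<noteq> {}"
  by (cases rule: engine_step.cases) (auto simp: valid_engine_def)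

lemma engine_step_valid:
  assumes "engine_step r rm \<chi> E e l e'" "wf_engine r E" "rm \<le> r" "valid_engine r E e"
  shows "valid_engine r E e'"
  using assms(1)
proof cases
  case (spark_jump a c d t h)
  then show ?thesis
    using assms engine_step_eifc_nonempty[OF assms(1,4)] wf_engine_code_sparks[of r E "\<chi> a" c]
    by (simp add: valid_engine_def length_pad)
next
  case (receive a c d t h)
  then show ?thesis
    using assms engine_step_eifc_nonempty[OF assms(1,4)] wf_engine_code_sparks[of r E a c]
    by (simp add: valid_engine_def length_pad)
qed (use assms engine_step_eifc_nonempty[OF assms(1,4)] in \<open>simp_all add: valid_engine_def\<close>)

lemma engine_step_output:
  assumes "engine_step r rm \<chi> E e (Some (Pro, (b, d))) e'" "rm \<le> r" "valid_engine r E e"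
  shows "\<exists>a. (Pro, a) \<in> eifc E \<and> b = \<chi> a \<and> length d = rm"
  using assms
  by (cases rule: engine_step.cases) (auto simp: valid_engine_def in_supp_pro_ports_iff)

text \<open>The connection map matters only at a spark, where it decides between a jump and an
  emission. Two maps that agree whenever one of them leads back into the engine take the same
  decision, with the same jump target. Emissions are excluded here because their labels may
  differ.\<close>

lemma engine_step_reroute:
  assumes step: "engine_step r rm \<chi> E e l e'"
    and valid: "valid_engine r E e"
    and \<chi>': "\<And>a. (Pro, a) \<in> eifc E \<Longrightarrow>
      (Opp, \<chi> a) \<in> eifc E \<or> (Opp, \<chi>' a) \<in> eifc E \<Longrightarrow> \<chi>' a = \<chi> a"
    and l: "\<And>x. l \<noteq> Some (Pro, x)"
  shows "engine_step r rm \<chi>' E e l e'"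
  using step
proof cases
  case (spark_jump a c d t h)
  then have "\<chi>' a = \<chi> a"
    using valid by (intro \<chi>') (auto simp: valid_engine_def in_supp_pro_ports_iff in_supp_opp_ports_iff)
  then show ?thesis
    using spark_jump engine_step.spark_jump[of \<chi>' a E c r rm d t h] by simp
qed (use l in \<open>auto intro: engine_step.intros\<close>)

text \<open>For an emission, changing the map keeps the step and changes only the port of the
  message.\<close>

lemma engine_step_reroute_output:
  assumes step: "engine_step r rm \<chi> E e (Some (Pro, (b, d))) e'"
    and valid: "valid_engine r E e"
    and \<chi>': "\<And>a. (Pro, a) \<in> eifc E \<Longrightarrow>
      (Opp, \<chi> a) \<in> eifc E \<or> (Opp, \<chi>' a) \<in> eifc E \<Longrightarrow> \<chi>' a = \<chi> a"
  shows "\<exists>a. (Pro, a) \<in> eifc E \<and> b = \<chi> a \<and> engine_step r rm \<chi>' E e (Some (Pro, (\<chi>' a, d))) e'"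
  using step
proof cases
  case (spark_send a d' t h)
  then have a: "(Pro, a) \<in> eifc E"
    using valid by (auto simp: valid_engine_def in_supp_pro_ports_iff)
  then have "\<chi>' a \<notin> supp (opp_ports (eifc E))"
    using \<chi>'[of a] spark_send by (metis in_supp_opp_ports_iff)
  then show ?thesis
    using a spark_send engine_step.spark_send[of \<chi>' a E r rm d' t h] by auto
qed

lemma valid_initial: "valid r rm S initial"
  by (simp add: valid_def valid_engine_def initial_def)

text \<open>Only \<open>send\<close> and \<open>env_input\<close> add pending messages, and both
  place them at the image under \<open>conn S\<close> of a source.\<close>

lemma net_step_valid:
  assumes step: "net_step r rm S n l n'" and wf: "wf_net r S" and rm: "rm \<le> r"
    and valid: "valid r rm S n"
  shows "valid r rm S n'"
proof -
  have wf_E: "wf_engine r E" if "E \<in> engines S" for E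
    using wf that by (simp add: wf_net_def)
  show ?thesis
    using step
  proof cases
    case (send E k x k' m)
    obtain b d where x: "x = (b, d)" by (cases x)
    obtain a where "(Pro, a) \<in> eifc E" "b = conn S a" "length d = rm"
      using engine_step_output[of r rm "conn S" E "k E" b d k'] rm valid send
      by (auto simp: x valid_def)
    moreover from this have "conn S a \<in> targets S"
      using send eifc_subset by (intro conn_in_targets[OF wf]) (auto simp: in_sources_iff)
    ultimately show ?thesis
      using send valid engine_step_valid[OF _ wf_E rm] by (auto simp: valid_def x)
  next
    case (env_input a d k m)
    then have "conn S a \<in> targets S"
      by (intro conn_in_targets[OF wf]) (auto simp: in_sources_iff)
    then show ?thesis
      using env_input valid by (auto simp: valid_def)
  qed (use valid engine_step_valid[OF _ wf_E rm] in \<open>auto simp: valid_def\<close>)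
qed

lemma net_step_label:
  assumes "net_step r rm S n (Some (l, (a, d))) n'" "valid r rm S n"
  shows "(l, a) \<in> ext S" "length d = rm"
  using assms by (cases rule: net_step.cases; auto simp: valid_def)+

lemma performs_traces_over:
  assumes "performs r rm S n s n'" "wf_net r S" "rm \<le> r" "valid r rm S n"
  shows "s \<in> traces_over rm (ext S)"
  using assms
proof induction
  case (observable n l n' s n'')
  obtain p a d where "l = (p, (a, d))" by (cases l) auto
  then show ?case
    using observable net_step_label[of r rm S n p a d n'] net_step_valid[of r rm S n "Some l" n']
    by (auto simp: traces_over_def in_supp_iff)
qed (auto simp: traces_over_def net_step_valid)

lemma performs_append:
  "performs r rm S n s n' \<Longrightarrow> performs r rm S n' t n'' \<Longrightarrow> performs r rm S n (s @ t) n''"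
  by (induction rule: performs.induct) (auto intro: performs.intros)

text \<open>The silent steps before the first observable one are split off.\<close>

lemma performs_Cons_split:
  "performs r rm S n (l # s) n' \<Longrightarrow>
    \<exists>n1 n2. performs r rm S n [] n1 \<and> net_step r rm S n1 (Some l) n2 \<and> performs r rm S n2 s n'"
  by (induction n "l # s" n' rule: performs.induct) (blast intro: performs.intros)+

section \<open>Synchronised traces\<close>

text \<open>An inductive form of trace composition: instead of deriving everything from one trace
  over all ports, it merges a trace of each component directly into the visible trace. Unlike
  \<open>trace_comp\<close>, it is evidently symmetric in the components.\<close>

inductive synchronised ::
  "port_name set \<Rightarrow> port_name set \<Rightarrow> (port_name \<Rightarrow> port_name) \<Rightarrow> trace \<Rightarrow> trace \<Rightarrow> trace \<Rightarrow> bool"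
  for X Y :: "port_name set" and \<rho> :: "port_name \<Rightarrow> port_name"
where
  nil: "synchronised X Y \<rho> [] [] []"
| left: "a \<notin> X \<Longrightarrow> synchronised X Y \<rho> s t u \<Longrightarrow>
    synchronised X Y \<rho> ((l, (a, d)) # s) t ((l, (a, d)) # u)"
| right: "a \<notin> Y \<Longrightarrow> synchronised X Y \<rho> s t u \<Longrightarrow>
    synchronised X Y \<rho> s ((l, (a, d)) # t) ((l, (a, d)) # u)"
| sync: "a \<in> X \<Longrightarrow> synchronised X Y \<rho> s t u \<Longrightarrow>
    synchronised X Y \<rho> ((l, (a, d)) # s) ((pol_dual l, (\<rho> a, d)) # t) u"

text \<open>Reversing polarity is an involution and \<open>\<rho>'\<close> undoes
  \<open>\<rho>\<close>, so \<open>sync\<close> is its own mirror image, while \<open>left\<close>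
  and \<open>right\<close> exchange roles.\<close>

lemma synchronised_swap:
  assumes "synchronised X Y \<rho> s t u" "\<And>a. a \<in> X \<Longrightarrow> \<rho> a \<in> Y \<and> \<rho>' (\<rho> a) = a"
  shows "synchronised Y X \<rho>' t s u"
  using assms
proof induction
  case (sync a s t u l d)
  then show ?case
    using synchronised.sync[of "\<rho> a" Y X \<rho>' t s u "pol_dual l" d] by simp
qed (auto intro: synchronised.intros)

text \<open>Each message of \<open>s\<close> lies on exactly one of \<open>A\<close>,
  \<open>B\<close> and \<open>C\<close>, which selects the rule \<open>left\<close>,
  \<open>sync\<close> or \<open>right\<close>.\<close>

lemma synchronised_traces:
  assumes s: "s \<in> traces_over rm (A \<otimes> B \<otimes> C)"
    and disj: "supp A \<inter> supp B = {}" "supp A \<inter> supp C = {}" "supp B \<inter> supp C = {}"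
    and \<pi>: "\<And>b. b \<in> supp B \<Longrightarrow> \<pi> b \<in> supp B' \<and> \<pi> b \<notin> supp A"
      "\<And>a. a \<in> supp A \<union> supp C \<Longrightarrow> \<pi> a = a"
    and B': "supp B' \<inter> supp C = {}"
  shows "synchronised (supp B) (supp B') \<pi> (trace_delete s C)
    (trace_delete (trace_rename \<pi> (trace_reverse B s)) A) (trace_delete s B)"
  using s
proof (induction s)
  case Nil
  show ?case
    by (simp add: trace_delete_def trace_rename_def trace_reverse_def synchronised.nil)
next
  case (Cons x s)
  obtain l a d where x: "x = (l, (a, d))" by (cases x) auto
  have IH: "synchronised (supp B) (supp B') \<pi> (trace_delete s C)
    (trace_delete (trace_rename \<pi> (trace_reverse B s)) A) (trace_delete s B)"
    using Cons by (auto simp: traces_over_def)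
  consider "a \<in> supp A" | "a \<in> supp B" | "a \<in> supp C"
    using Cons.prems by (auto simp: traces_over_def x supp_tensor)
  then show ?case
  proof cases
    case 1
    then have "a \<notin> supp B" "a \<notin> supp C" "\<pi> a = a" using disj \<pi> by auto
    then show ?thesis using 1 synchronised.left[OF _ IH]
      by (simp add: x trace_delete_def trace_rename_def trace_reverse_def)
  next
    case 2
    then have "a \<notin> supp A" "a \<notin> supp C" "\<pi> a \<notin> supp A" using disj \<pi> by auto
    then show ?thesis using 2 synchronised.sync[OF _ IH]
      by (simp add: x trace_delete_def trace_rename_def trace_reverse_def)
  next
    case 3
    then have "a \<notin> supp B" "a \<notin> supp B'" "a \<notin> supp A" "\<pi> a = a" using disj \<pi> B' by auto
    then show ?thesis using 3 synchronised.right[OF _ IH]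
      by (simp add: x trace_delete_def trace_rename_def trace_reverse_def)
  qed
qed

text \<open>The converse: every rule application contributes one message to the common
  trace.\<close>

lemma synchronised_obtain_trace:
  assumes "synchronised (supp B) (supp B') \<pi> t\<^sub>1 t\<^sub>2 u"
    and "t\<^sub>1 \<in> traces_over rm (A \<otimes> B)" "t\<^sub>2 \<in> traces_over rm (B' \<otimes> C)"
    and disj: "supp A \<inter> supp B = {}" "supp A \<inter> supp C = {}" "supp B \<inter> supp C = {}"
    and \<pi>: "\<And>b. b \<in> supp B \<Longrightarrow> \<pi> b \<in> supp B' \<and> \<pi> b \<notin> supp A"
      "\<And>a. a \<in> supp A \<union> supp C \<Longrightarrow> \<pi> a = a"
  shows "\<exists>s \<in> traces_over rm (A \<otimes> B \<otimes> C). t\<^sub>1 = trace_delete s C \<and>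
    t\<^sub>2 = trace_delete (trace_rename \<pi> (trace_reverse B s)) A \<and> u = trace_delete s B"
  using assms(1-3)
proof induction
  case nil
  show ?case
    by (intro bexI[of _ "[]"])
      (auto simp: trace_delete_def trace_rename_def trace_reverse_def traces_over_def)
next
  case (left a s t u l d)
  then obtain w where "w \<in> traces_over rm (A \<otimes> B \<otimes> C)" "s = trace_delete w C"
    "t = trace_delete (trace_rename \<pi> (trace_reverse B w)) A" "u = trace_delete w B"
    by (auto simp: traces_over_def)
  moreover have "a \<in> supp A" "length d = rm"
    using left by (auto simp: traces_over_def supp_tensor)
  moreover from this have "a \<notin> supp C" "\<pi> a = a" using disj \<pi> by auto
  ultimately show ?case
    using left.hyps by (intro bexI[of _ "(l, (a, d)) # w"])
      (auto simp: trace_delete_def trace_rename_def trace_reverse_def traces_over_def supp_tensor)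
next
  case (right a s t u l d)
  then obtain w where "w \<in> traces_over rm (A \<otimes> B \<otimes> C)" "s = trace_delete w C"
    "t = trace_delete (trace_rename \<pi> (trace_reverse B w)) A" "u = trace_delete w B"
    by (auto simp: traces_over_def)
  moreover have "a \<in> supp C" "length d = rm"
    using right by (auto simp: traces_over_def supp_tensor)
  moreover from this have "a \<notin> supp A" "a \<notin> supp B" "\<pi> a = a" using disj \<pi> by auto
  ultimately show ?case
    using right.hyps by (intro bexI[of _ "(l, (a, d)) # w"])
      (auto simp: trace_delete_def trace_rename_def trace_reverse_def traces_over_def supp_tensor)
next
  case (sync a s t u l d)
  then obtain w where "w \<in> traces_over rm (A \<otimes> B \<otimes> C)" "s = trace_delete w C"
    "t = trace_delete (trace_rename \<pi> (trace_reverse B w)) A" "u = trace_delete w B"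
    by (auto simp: traces_over_def)
  moreover have "length d = rm"
    using sync by (auto simp: traces_over_def supp_tensor)
  moreover have "a \<notin> supp C" "\<pi> a \<notin> supp A" using disj \<pi> sync.hyps by auto
  \<comment> \<open>A hidden message enters the common trace as the first component sees it;
    \<open>trace_reverse\<close> and \<open>trace_rename\<close> then produce the view of the
    second.\<close>
  ultimately show ?case
    using sync.hyps by (intro bexI[of _ "(l, (a, d)) # w"])
      (auto simp: trace_delete_def trace_rename_def trace_reverse_def traces_over_def supp_tensor)
qed

section \<open>Simulation between a composite net and its components\<close>

text \<open>The port at which a message pending at the hidden port \<open>a\<close> ends up in the composite net.\<close>

definition forward :: "port_name set \<Rightarrow> (port_name \<Rightarrow> port_name) \<Rightarrow> net \<Rightarrow> port_name \<Rightarrow> port_name" where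
  "forward X \<rho> S a = (if a \<in> X then conn S (\<rho> a) else a)"

text \<open>The rule \<open>env_input\<close> with \<open>conn\<close> and \<open>ext\<close>
  evaluated, so that it matches goals about an explicit \<open>Net\<close>.\<close>

lemma net_step_env_input:
  "(Opp, a) \<in> K \<Longrightarrow>
    net_step r (length d) (Net M \<chi> K) (k, m) (Some (Opp, (a, d))) (k, add_mset (\<chi> a, d) m)"
  using net_step.env_input[of a "Net M \<chi> K" d "length d" r k m] by simp

text \<open>A step involves a single engine or a single external port, hence belongs to one of the
  two halves.\<close>

lemma net_step_union:
  assumes "net_step r rm (Net (M \<union> N) \<chi> (K \<union> L)) n l n'"
  shows "net_step r rm (Net M \<chi> K) n l n' \<or> net_step r rm (Net N \<chi> L) n l n'"
  using assms by cases (auto intro: net_step.intros net_step_env_input)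

lemma net_step_mono:
  assumes "net_step r rm (Net M \<chi> K) n l n'" "M \<subseteq> N" "K \<subseteq> L"
  shows "net_step r rm (Net N \<chi> L) n l n'"
  using assms by cases (auto intro!: net_step.intros net_step_env_input)

text \<open>
  The assumptions are invariant under exchanging the two components \<open>F\<close> and \<open>G\<close>, whose
  hidden ports \<open>X\<close> and \<open>Y\<close> are identified along \<open>\<rho>\<close>.
\<close>

locale net_composition =
  fixes r rm :: nat and F G H :: net and X Y :: "port_name set" and \<rho> \<rho>' :: "port_name \<Rightarrow> port_name"
  assumes rm_le: "rm \<le> r"
    and wf_F: "wf_net r F" and wf_G: "wf_net r G" and wf_H: "wf_net r H"
    and engines_H: "engines H = engines F \<union> engines G"
    and ext_H: "ext H = {p \<in> ext F. snd p \<notin> X} \<union> {p \<in> ext G. snd p \<notin> Y}"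
    and conn_H_F: "a \<in> sources F \<Longrightarrow> a \<notin> X \<Longrightarrow> conn H a = forward X \<rho> G (conn F a)"
    and conn_H_G: "a \<in> sources G \<Longrightarrow> a \<notin> Y \<Longrightarrow> conn H a = forward Y \<rho>' F (conn G a)"
    and X_subset: "X \<subseteq> supp (ext F)" and Y_subset: "Y \<subseteq> supp (ext G)"
    and private_F: "(port_names F - X) \<inter> port_names G = {}"
    and private_G: "(port_names G - Y) \<inter> port_names F = {}"
    and \<rho>: "a \<in> X \<Longrightarrow> \<rho> a \<in> Y \<and> \<rho>' (\<rho> a) = a"
    and \<rho>': "a \<in> Y \<Longrightarrow> \<rho>' a \<in> X \<and> \<rho> (\<rho>' a) = a"
    and \<rho>_ext: "a \<in> X \<Longrightarrow> (l, a) \<in> ext F \<Longrightarrow> (pol_dual l, \<rho> a) \<in> ext G"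
    and \<rho>'_ext: "a \<in> Y \<Longrightarrow> (l, a) \<in> ext G \<Longrightarrow> (pol_dual l, \<rho>' a) \<in> ext F"
begin

text \<open>Every fact about \<open>F\<close> below yields its mirror image for \<open>G\<close> by
  instantiating the locale along this lemma, so each argument is given for one side only.\<close>

lemma swap: "net_composition r rm G F H Y X \<rho>' \<rho>"
proof (rule net_composition.intro)
  show "engines H = engines G \<union> engines F"
    using engines_H by blast
  show "ext H = {p \<in> ext G. snd p \<notin> Y} \<union> {p \<in> ext F. snd p \<notin> X}"
    using ext_H by blast
qed (fact rm_le wf_F wf_G wf_H conn_H_F conn_H_G X_subset Y_subset private_F private_G
  \<rho> \<rho>' \<rho>_ext \<rho>'_ext)+

section \<open>Visible and hidden ports of the composite net\<close>

lemma X_not_engine: "a \<in> X \<Longrightarrow> (l, a) \<notin> engine_ifc F"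
  using X_subset wf_F in_supp_iff[of a "engine_ifc F"] unfolding wf_net_def by blast

lemma engine_private: "(l, a) \<in> engine_ifc F \<Longrightarrow> a \<notin> port_names G"
  using X_not_engine[of a l] private_F in_supp_iff[of a "engine_ifc F"]
  unfolding port_names_def[of F] by blast

lemma engine_ifc_H: "engine_ifc H = engine_ifc F \<union> engine_ifc G"
  by (auto simp: engine_ifc_def engines_H)

lemma targets_H: "a \<in> targets H \<Longrightarrow> a \<in> targets F \<and> a \<notin> X \<or> a \<in> targets G \<and> a \<notin> Y"
  using X_not_engine net_composition.X_not_engine[OF swap]
  by (auto simp: in_targets_iff ext_H engine_ifc_H)

text \<open>
  As \<open>H\<close> is well-formed, a connection from a visible port crosses the hidden interface at most
  once. A closed loop through hidden ports remains possible, but no message ever enters it.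
\<close>

lemma conn_crossing:
  assumes a: "a \<in> sources F" "a \<notin> X" "conn F a \<in> X"
  shows "conn G (\<rho> (conn F a)) \<in> targets G" "conn G (\<rho> (conn F a)) \<notin> Y"
proof -
  have "(Pro, conn F a) \<in> ext F"
    using conn_in_targets[OF wf_F a(1)] X_not_engine[OF a(3)] by (auto simp: in_targets_iff)
  then have "\<rho> (conn F a) \<in> sources G"
    using \<rho>_ext[OF a(3)] by (force simp: in_sources_iff)
  then show targets: "conn G (\<rho> (conn F a)) \<in> targets G"
    by (rule conn_in_targets[OF wf_G])
  have "a \<in> sources H"
    using a by (auto simp: in_sources_iff ext_H engine_ifc_H)
  from conn_in_targets[OF wf_H this] have "conn G (\<rho> (conn F a)) \<in> targets H"
    unfolding conn_H_F[OF a(1,2)] using a(3) by (simp add: forward_def)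
  \<comment> \<open>A target of \<open>H\<close> is a visible target of \<open>F\<close> or of
    \<open>G\<close>. The former is impossible, since this one is a port of \<open>G\<close> and the
    visible ports of \<open>F\<close> are not.\<close>
  then show "conn G (\<rho> (conn F a)) \<notin> Y"
    using targets_H targets targets_subset[of F] targets_subset[of G] private_F by blast
qed

text \<open>The two maps differ only where \<open>F\<close> connects to a hidden port. That port
  belongs to no engine of \<open>F\<close>, and the rerouted connection ends at a port of
  \<open>G\<close>, so neither leads back into \<open>E\<close>. This is the agreement that
  \<open>engine_step_reroute\<close> asks for.\<close>

lemma conn_H_local:
  assumes "E \<in> engines F" "(Pro, a) \<in> eifc E"
    and "(Opp, conn F a) \<in> eifc E \<or> (Opp, conn H a) \<in> eifc E"
  shows "conn H a = conn F a"
proof (rule ccontr)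
  assume neq: "conn H a \<noteq> conn F a"
  have a: "(Pro, a) \<in> engine_ifc F"
    using assms eifc_subset by blast
  then have sources: "a \<in> sources F" "a \<notin> X"
    using X_not_engine by (auto simp: in_sources_iff)
  then have cross: "conn F a \<in> X" "conn H a = conn G (\<rho> (conn F a))"
    using conn_H_F neq by (auto simp: forward_def split: if_splits)
  then have "conn H a \<in> port_names G"
    using conn_crossing(1)[OF sources] targets_subset by auto
  then show False
    using assms eifc_subset[OF assms(1)] engine_private X_not_engine[OF cross(1)] by blast
qed

lemma conn_F_local:
  assumes "E \<in> engines F" "(Pro, a) \<in> eifc E"
    and "(Opp, conn H a) \<in> eifc E \<or> (Opp, conn F a) \<in> eifc E"
  shows "conn F a = conn H a"
  using conn_H_local assms by metis

text \<open>An engine common to both nets has an empty interface and never moves. Updating the state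
  of a moving engine of \<open>F\<close> therefore leaves the engines of \<open>G\<close>
  untouched.\<close>

lemma engine_step_not_G:
  assumes "E \<in> engines F" "engine_step r rm \<chi> E e l e'" "valid_engine r E e"
  shows "E \<notin> engines G"
proof
  assume "E \<in> engines G"
  moreover obtain l a where "(l, a) \<in> eifc E"
    using engine_step_eifc_nonempty[OF assms(2,3)] by auto
  ultimately show False
    using eifc_subset[OF assms(1)] eifc_subset[of E G] engine_private[of l a]
    by (auto simp: port_names_def in_supp_iff)
qed

text \<open>The last two conjuncts say that a pending hidden message becomes visible after one
  handover. They exclude messages caught in a loop of hidden ports, for which handing over need not
  end.\<close>

definition coupled :: "net_config \<Rightarrow> net_config \<Rightarrow> net_config \<Rightarrow> bool" where
  "coupled n\<^sub>F n\<^sub>G n \<longleftrightarrow>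
     valid r rm F n\<^sub>F \<and> valid r rm G n\<^sub>G \<and>
     (\<forall>E \<in> engines F. fst n E = fst n\<^sub>F E) \<and> (\<forall>E \<in> engines G. fst n E = fst n\<^sub>G E) \<and>
     snd n = image_mset (apfst (forward X \<rho> G)) (snd n\<^sub>F) +
             image_mset (apfst (forward Y \<rho>' F)) (snd n\<^sub>G) \<and>
     (\<forall>(a, d) \<in># snd n\<^sub>F. a \<in> X \<longrightarrow> conn G (\<rho> a) \<notin> Y) \<and>
     (\<forall>(a, d) \<in># snd n\<^sub>G. a \<in> Y \<longrightarrow> conn F (\<rho>' a) \<notin> X)"

lemma coupled_swap: "net_composition.coupled r rm G F Y X \<rho>' \<rho> n\<^sub>G n\<^sub>F n \<longleftrightarrow> coupled n\<^sub>F n\<^sub>G n"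
  unfolding coupled_def net_composition.coupled_def[OF swap] by (auto simp: add.commute)

lemma coupled_initial: "coupled initial initial initial"
  using valid_initial by (simp add: coupled_def) (simp add: initial_def)

text \<open>The share of \<open>F\<close> in the composite: its engines and visible ports, but wired
  by the connection map of \<open>H\<close>. Each step of \<open>H\<close> is a step of this net or
  of its mirror image for \<open>G\<close>.\<close>

definition part :: net where
  "part = Net (engines F) (conn H) {p \<in> ext F. snd p \<notin> X}"

lemma H_eq: "H = Net (engines F \<union> engines G) (conn H)
    ({p \<in> ext F. snd p \<notin> X} \<union> {p \<in> ext G. snd p \<notin> Y})"
  by (simp flip: engines_H ext_H)

lemma part_step: "net_step r rm part n l n' \<Longrightarrow> net_step r rm H n l n'"
  unfolding part_def by (subst H_eq) (erule net_step_mono; blast)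

lemma step_cases:
  assumes "net_step r rm H n l n'"
  shows "net_step r rm part n l n' \<or> net_step r rm (net_composition.part G H Y) n l n'"
  unfolding part_def net_composition.part_def[OF swap]
  using assms by (subst (asm) H_eq) (rule net_step_union)

text \<open>Steps at hidden ports are excluded, as they correspond to no step of \<open>H\<close>;
  \<open>coupled_sync\<close> deals with them in pairs.\<close>

lemma step_simulation:
  assumes coupled: "coupled n\<^sub>F n\<^sub>G n" and step: "net_step r rm F n\<^sub>F l n\<^sub>F'"
    and visible: "\<And>p a d. l = Some (p, (a, d)) \<Longrightarrow> a \<notin> X"
  shows "\<exists>n'. net_step r rm part n l n' \<and> coupled n\<^sub>F' n\<^sub>G n'"
proof -
  obtain k m where n: "n = (k, m)" by fastforce
  have valid: "valid r rm F n\<^sub>F'"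
    using net_step_valid[OF step wf_F rm_le] coupled by (simp add: coupled_def)
  have valid_E: "valid_engine r E (fst n\<^sub>F E)" and same_E: "fst n\<^sub>F E = k E" if "E \<in> engines F" for E
    using coupled that by (auto simp: coupled_def valid_def n)
  show ?thesis
    using step
  proof cases
    case (silent E k\<^sub>F k' m\<^sub>F)
    have "engine_step r rm (conn H) E (k E) None k'"
      using engine_step_reroute[OF silent(5) _ conn_H_local[OF silent(4)]] valid_E[of E] same_E[of E]
        silent
      by simp
    then have "net_step r rm part n None (k(E := k'), m)"
      using silent by (auto simp: n part_def intro: net_step.intros)
    moreover have "E \<notin> engines G"
      using engine_step_not_G[OF silent(4,5)] valid_E[of E] silent by simp
    then have "coupled n\<^sub>F' n\<^sub>G (k(E := k'), m)"
      using coupled valid silent by (auto simp: coupled_def n)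
    ultimately show ?thesis
      using silent by blast
  next
    case (send E k\<^sub>F x k' m\<^sub>F)
    obtain b d where x: "x = (b, d)" by fastforce
    obtain a where a: "(Pro, a) \<in> eifc E" "b = conn F a"
      and step_H: "engine_step r rm (conn H) E (k E) (Some (Pro, (conn H a, d))) k'"
      using engine_step_reroute_output[OF send(5)[unfolded x] _ conn_H_local[OF send(4)]]
        valid_E[of E] same_E[of E] send
      by auto
    have "(Pro, a) \<in> engine_ifc F"
      using a send eifc_subset by blast
    then have sources: "a \<in> sources F" "a \<notin> X"
      using X_not_engine by (auto simp: in_sources_iff)
    \<comment> \<open>By \<open>conn_H_F\<close>, the composite puts the message exactly where
      \<open>forward\<close> moves the port \<open>conn F a\<close>. By
      \<open>conn_crossing\<close>, one handover suffices if that port is hidden.\<close>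
    have "net_step r rm part n None (k(E := k'), add_mset (conn H a, d) m)"
      using send step_H by (auto simp: n part_def intro: net_step.intros)
    moreover have "E \<notin> engines G"
      using engine_step_not_G[OF send(4,5)] valid_E[of E] send by simp
    then have "coupled n\<^sub>F' n\<^sub>G (k(E := k'), add_mset (conn H a, d) m)"
      using coupled valid send conn_H_F[OF sources] conn_crossing(2)[OF sources]
      by (auto simp: coupled_def n x a(2))
    ultimately show ?thesis
      using send by blast
  next
    case (receive E k\<^sub>F x k' m\<^sub>F)
    obtain a d where x: "x = (a, d)" by fastforce
    have "(Opp, a) \<in> eifc E"
      using receive(5) by cases (auto simp: x)
    then have a: "a \<notin> X"
      using eifc_subset[OF receive(4)] X_not_engine by blast
    \<comment> \<open>The pool of \<open>H\<close> after removal of the received message, which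
      \<open>forward\<close> leaves in place because its port is not hidden.\<close>
    define m' where "m' = image_mset (apfst (forward X \<rho> G)) m\<^sub>F +
      image_mset (apfst (forward Y \<rho>' F)) (snd n\<^sub>G)"
    have m: "m = add_mset x m'"
      using coupled a receive by (simp add: coupled_def n m'_def x forward_def)
    have "engine_step r rm (conn H) E (k E) (Some (Opp, x)) k'"
      using engine_step_reroute[OF receive(5) _ conn_H_local[OF receive(4)]] valid_E[of E] same_E[of E] receive
      by simp
    then have "net_step r rm part n None (k(E := k'), m')"
      using receive by (auto simp: n m part_def intro: net_step.intros)
    moreover have "E \<notin> engines G"
      using engine_step_not_G[OF receive(4,5)] valid_E[of E] receive by simp
    then have "coupled n\<^sub>F' n\<^sub>G (k(E := k'), m')"
      using coupled valid receive by (auto simp: coupled_def n m'_def)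
    ultimately show ?thesis
      using receive by blast
  next
    case (env_input a d k\<^sub>F m\<^sub>F)
    have sources: "a \<in> sources F" "a \<notin> X"
      using env_input visible by (auto simp: in_sources_iff)
    have "net_step r rm part n l (k, add_mset (conn H a, d) m)"
      using env_input sources net_step.env_input[of a part d rm r k m] by (simp add: n part_def)
    moreover have "coupled n\<^sub>F' n\<^sub>G (k, add_mset (conn H a, d) m)"
      using coupled valid env_input conn_H_F[OF sources] conn_crossing(2)[OF sources]
      by (auto simp: coupled_def n)
    ultimately show ?thesis
      by blast
  next
    case (env_output a k\<^sub>F d m\<^sub>F)
    have a: "a \<notin> X"
      using env_output visible by blast
    define m' where "m' = image_mset (apfst (forward X \<rho> G)) m\<^sub>F +
      image_mset (apfst (forward Y \<rho>' F)) (snd n\<^sub>G)"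
    have m: "m = add_mset (a, d) m'"
      using coupled a env_output by (simp add: coupled_def n m'_def forward_def)
    have "net_step r rm part n l (k, m')"
      using env_output a net_step.env_output[of a part r rm k d m'] by (simp add: n m part_def)
    moreover have "coupled n\<^sub>F' n\<^sub>G (k, m')"
      using coupled valid env_output by (auto simp: coupled_def n m'_def)
    ultimately show ?thesis
      by blast
  qed
qed

text \<open>With no message at a hidden port, \<open>forward\<close> moves nothing, so the pool of
  \<open>H\<close> is the sum of the two pools. The pool of \<open>G\<close> contributes no message
  at a visible port of \<open>F\<close>.\<close>

lemma pending_in_F:
  assumes coupled: "coupled n\<^sub>F n\<^sub>G n"
    and flushed: "\<forall>(a, d) \<in># snd n\<^sub>F. a \<notin> X" "\<forall>(a, d) \<in># snd n\<^sub>G. a \<notin> Y"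
    and pending: "(a, d) \<in># snd n" and a: "a \<in> port_names F" "a \<notin> X"
  shows "(a, d) \<in># snd n\<^sub>F"
proof -
  have "(a, d) \<in># snd n\<^sub>F \<or> (a, d) \<in># snd n\<^sub>G"
    using coupled pending flushed by (auto simp: coupled_def forward_def)
  moreover have "(a, d) \<notin># snd n\<^sub>G"
    using coupled a private_F targets_subset[of G] by (auto simp: coupled_def valid_def)
  ultimately show ?thesis by blast
qed

text \<open>The flushing assumptions matter when a message is consumed: otherwise the message that
  \<open>H\<close> takes from a port of \<open>F\<close> might still wait at a hidden port of
  \<open>G\<close>.\<close>

lemma step_reflection:
  assumes coupled: "coupled n\<^sub>F n\<^sub>G n" and step: "net_step r rm part n l n'"
    and flushed: "\<forall>(a, d) \<in># snd n\<^sub>F. a \<notin> X" "\<forall>(a, d) \<in># snd n\<^sub>G. a \<notin> Y"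
  shows "\<exists>n\<^sub>F'. net_step r rm F n\<^sub>F l n\<^sub>F' \<and> coupled n\<^sub>F' n\<^sub>G n' \<and>
    (\<forall>p a d. l = Some (p, (a, d)) \<longrightarrow> a \<notin> X)"
proof -
  obtain k\<^sub>F m\<^sub>F where n\<^sub>F: "n\<^sub>F = (k\<^sub>F, m\<^sub>F)" by fastforce
  have valid: "valid r rm F n" if "net_step r rm F n\<^sub>F l n" for n
    using net_step_valid[OF that wf_F rm_le] coupled by (simp add: coupled_def)
  have valid_E: "valid_engine r E (k\<^sub>F E)" and same_E: "fst n E = k\<^sub>F E" if "E \<in> engines F" for E
    using coupled that by (auto simp: coupled_def valid_def n\<^sub>F)
  show ?thesis
    using step
  proof cases
    case (silent E k k' m)
    then have E: "E \<in> engines F" "engine_step r rm (conn H) E (k\<^sub>F E) None k'"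
      using same_E by (auto simp: part_def)
    have "engine_step r rm (conn F) E (k\<^sub>F E) None k'"
      by (rule engine_step_reroute[OF E(2) valid_E[OF E(1)] conn_F_local[OF E(1)]]) simp_all
    then have "net_step r rm F n\<^sub>F None (k\<^sub>F(E := k'), m\<^sub>F)"
      using E by (auto simp: n\<^sub>F intro: net_step.intros)
    moreover have "E \<notin> engines G"
      using engine_step_not_G[OF E] valid_E E by simp
    then have "coupled (k\<^sub>F(E := k'), m\<^sub>F) n\<^sub>G n'"
      using coupled valid calculation silent by (auto simp: coupled_def n\<^sub>F)
    ultimately show ?thesis
      using silent by blast
  next
    case (send E k x k' m)
    obtain b d where x: "x = (b, d)" by fastforce
    have E: "E \<in> engines F" "engine_step r rm (conn H) E (k\<^sub>F E) (Some (Pro, (b, d))) k'"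
      using same_E[of E] send by (auto simp: part_def x)
    obtain a where a: "(Pro, a) \<in> eifc E" "b = conn H a"
      and step_F: "engine_step r rm (conn F) E (k\<^sub>F E) (Some (Pro, (conn F a, d))) k'"
      using engine_step_reroute_output[OF E(2) valid_E[OF E(1)] conn_F_local[OF E(1)]] by auto
    have "(Pro, a) \<in> engine_ifc F"
      using a E eifc_subset by blast
    then have sources: "a \<in> sources F" "a \<notin> X"
      using X_not_engine by (auto simp: in_sources_iff)
    have "net_step r rm F n\<^sub>F None (k\<^sub>F(E := k'), add_mset (conn F a, d) m\<^sub>F)"
      using E step_F by (auto simp: n\<^sub>F intro: net_step.intros)
    moreover have "E \<notin> engines G"
      using engine_step_not_G[OF E] valid_E E by simp
    then have "coupled (k\<^sub>F(E := k'), add_mset (conn F a, d) m\<^sub>F) n\<^sub>G n'"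
      using coupled valid calculation send conn_H_F[OF sources] conn_crossing(2)[OF sources]
      by (auto simp: coupled_def n\<^sub>F x a(2))
    ultimately show ?thesis
      using send by blast
  next
    case (receive E k x k' m)
    obtain a d where x: "x = (a, d)" by fastforce
    have E: "E \<in> engines F" "engine_step r rm (conn H) E (k\<^sub>F E) (Some (Opp, (a, d))) k'"
      using same_E[of E] receive by (auto simp: part_def x)
    have "(Opp, a) \<in> eifc E"
      using E(2) by cases auto
    then have "(Opp, a) \<in> engine_ifc F"
      using eifc_subset[OF E(1)] by blast
    then have a: "a \<in> port_names F" "a \<notin> X"
      using X_not_engine by (auto simp: port_names_def in_supp_iff)
    have "(a, d) \<in># m\<^sub>F"
      using pending_in_F[OF coupled flushed _ a] receive by (simp add: n\<^sub>F x)
    then obtain m\<^sub>F' where m\<^sub>F: "m\<^sub>F = add_mset (a, d) m\<^sub>F'"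
      by (metis multi_member_split)
    have "engine_step r rm (conn F) E (k\<^sub>F E) (Some (Opp, (a, d))) k'"
      by (rule engine_step_reroute[OF E(2) valid_E[OF E(1)] conn_F_local[OF E(1)]]) simp_all
    then have "net_step r rm F n\<^sub>F None (k\<^sub>F(E := k'), m\<^sub>F')"
      using E by (auto simp: n\<^sub>F m\<^sub>F intro: net_step.intros)
    moreover have "E \<notin> engines G"
      using engine_step_not_G[OF E] valid_E E by simp
    then have "coupled (k\<^sub>F(E := k'), m\<^sub>F') n\<^sub>G n'"
      using coupled valid calculation receive a by (auto simp: coupled_def n\<^sub>F m\<^sub>F x forward_def)
    ultimately show ?thesis
      using receive by blast
  next
    case (env_input a d k m)
    have sources: "a \<in> sources F" "a \<notin> X"
      using env_input by (auto simp: in_sources_iff part_def)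
    have "net_step r rm F n\<^sub>F l (k\<^sub>F, add_mset (conn F a, d) m\<^sub>F)"
      using env_input net_step.env_input[of a F d rm r k\<^sub>F m\<^sub>F] by (simp add: n\<^sub>F part_def)
    moreover have "coupled (k\<^sub>F, add_mset (conn F a, d) m\<^sub>F) n\<^sub>G n'"
      using coupled valid calculation env_input conn_H_F[OF sources] conn_crossing(2)[OF sources]
      by (auto simp: coupled_def n\<^sub>F part_def)
    ultimately show ?thesis
      using env_input sources by blast
  next
    case (env_output a k d m)
    have a: "(Pro, a) \<in> ext F" "a \<notin> X"
      using env_output by (auto simp: part_def)
    then have "(a, d) \<in># m\<^sub>F"
      using pending_in_F[OF coupled flushed, of a d] env_output
      by (auto simp: n\<^sub>F port_names_def in_supp_iff)
    then obtain m\<^sub>F' where m\<^sub>F: "m\<^sub>F = add_mset (a, d) m\<^sub>F'"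
      by (metis multi_member_split)
    have "net_step r rm F n\<^sub>F l (k\<^sub>F, m\<^sub>F')"
      using env_output a net_step.env_output[of a F r rm k\<^sub>F d m\<^sub>F'] by (simp add: n\<^sub>F m\<^sub>F)
    moreover have "coupled (k\<^sub>F, m\<^sub>F') n\<^sub>G n'"
      using coupled valid calculation env_output a by (auto simp: coupled_def n\<^sub>F m\<^sub>F forward_def)
    ultimately show ?thesis
      using env_output a by blast
  qed
qed

text \<open>One handover: an output of \<open>F\<close> paired with an input of \<open>G\<close>.
  The configuration of \<open>H\<close> is unchanged, because \<open>forward\<close> already counted
  the message at the port \<open>conn G (\<rho> a)\<close>.\<close>

lemma coupled_sync:
  assumes coupled: "coupled (k\<^sub>F, add_mset (a, d) m\<^sub>F) (k\<^sub>G, m\<^sub>G) n" and a: "a \<in> X"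
  shows "net_step r rm F (k\<^sub>F, add_mset (a, d) m\<^sub>F) (Some (Pro, (a, d))) (k\<^sub>F, m\<^sub>F)"
    and "net_step r rm G (k\<^sub>G, m\<^sub>G) (Some (Opp, (\<rho> a, d))) (k\<^sub>G, add_mset (conn G (\<rho> a), d) m\<^sub>G)"
    and "conn G (\<rho> a) \<notin> Y"
    and "coupled (k\<^sub>F, m\<^sub>F) (k\<^sub>G, add_mset (conn G (\<rho> a), d) m\<^sub>G) n"
proof -
  have a_ext: "(Pro, a) \<in> ext F" and d: "length d = rm"
    using coupled X_not_engine[OF a] by (auto simp: coupled_def valid_def in_targets_iff)
  show F: "net_step r rm F (k\<^sub>F, add_mset (a, d) m\<^sub>F) (Some (Pro, (a, d))) (k\<^sub>F, m\<^sub>F)"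
    using a_ext by (rule net_step.env_output)
  show G: "net_step r rm G (k\<^sub>G, m\<^sub>G) (Some (Opp, (\<rho> a, d))) (k\<^sub>G, add_mset (conn G (\<rho> a), d) m\<^sub>G)"
    using \<rho>_ext[OF a a_ext] d by (intro net_step.env_input) auto
  show notin: "conn G (\<rho> a) \<notin> Y"
    using coupled a by (simp add: coupled_def)
  show "coupled (k\<^sub>F, m\<^sub>F) (k\<^sub>G, add_mset (conn G (\<rho> a), d) m\<^sub>G) n"
    using coupled a notin net_step_valid[OF F wf_F rm_le] net_step_valid[OF G wf_G rm_le]
    by (auto simp: coupled_def forward_def)
qed

text \<open>Inverting the two steps shows that they have the form treated in
  \<open>coupled_sync\<close>.\<close>

lemma coupled_sync_step:
  assumes "coupled n\<^sub>F n\<^sub>G n" "a \<in> X"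
    and "net_step r rm F n\<^sub>F (Some (Pro, (a, d))) n\<^sub>F'"
    and "net_step r rm G n\<^sub>G (Some (Opp, (\<rho> a, d))) n\<^sub>G'"
  shows "coupled n\<^sub>F' n\<^sub>G' n"
  using assms(3)
proof cases
  case F: (env_output k\<^sub>F m\<^sub>F)
  show ?thesis
    using assms(4)
  proof cases
    case G: (env_input k\<^sub>G m\<^sub>G)
    then show ?thesis
      using coupled_sync(4)[OF assms(1)[unfolded F G] assms(2)] F by simp
  qed
qed

section \<open>From runs of the components to a run of the composite\<close>

lemma silent_simulation:
  assumes "performs r rm F n\<^sub>F [] n\<^sub>F'" "coupled n\<^sub>F n\<^sub>G n"
  shows "\<exists>n'. performs r rm H n [] n' \<and> coupled n\<^sub>F' n\<^sub>G n'"
  using assms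
proof (induction n\<^sub>F "[] :: trace" n\<^sub>F' arbitrary: n rule: performs.induct)
  case (stop n\<^sub>F)
  then show ?case by (blast intro: performs.stop)
next
  case (silent n\<^sub>F n\<^sub>F1 n\<^sub>F2)
  then obtain n1 where "net_step r rm part n None n1" "coupled n\<^sub>F1 n\<^sub>G n1"
    using step_simulation by blast
  then show ?case
    using silent part_step by (blast intro: performs.silent)
qed

lemma visible_simulation:
  assumes "performs r rm F n\<^sub>F ((l, (a, d)) # s) n\<^sub>F'" "coupled n\<^sub>F n\<^sub>G n" "a \<notin> X"
  shows "\<exists>n\<^sub>F1 n1. performs r rm F n\<^sub>F1 s n\<^sub>F' \<and> coupled n\<^sub>F1 n\<^sub>G n1 \<and>
    performs r rm H n [(l, (a, d))] n1"
proof -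
  obtain n\<^sub>F1 n\<^sub>F2 where F: "performs r rm F n\<^sub>F [] n\<^sub>F1" "net_step r rm F n\<^sub>F1 (Some (l, (a, d))) n\<^sub>F2"
    "performs r rm F n\<^sub>F2 s n\<^sub>F'"
    using performs_Cons_split[OF assms(1)] by blast
  obtain n1 where n1: "performs r rm H n [] n1" "coupled n\<^sub>F1 n\<^sub>G n1"
    using silent_simulation[OF F(1) assms(2)] by blast
  obtain n2 where n2: "net_step r rm H n1 (Some (l, (a, d))) n2" "coupled n\<^sub>F2 n\<^sub>G n2"
    using step_simulation[OF n1(2) F(2)] assms(3) part_step by blast
  have "performs r rm H n [(l, (a, d))] n2"
    using performs_append[OF n1(1) performs.observable[OF n2(1) performs.stop]] by simp
  then show ?thesis
    using F(3) n2(2) by blast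
qed

text \<open>Induction on the merging of the two traces. For a hidden message, \<open>H\<close>
  replays only the silent steps that precede it in both components; the exchange itself costs no
  step.\<close>

lemma performs_compose:
  assumes "synchronised X Y \<rho> s t u" "performs r rm F n\<^sub>F s n\<^sub>F'" "performs r rm G n\<^sub>G t n\<^sub>G'"
    "coupled n\<^sub>F n\<^sub>G n"
  shows "\<exists>n'. performs r rm H n u n'"
  using assms
proof (induction arbitrary: n\<^sub>F n\<^sub>G n)
  case nil
  show ?case
    by (blast intro: performs.stop)
next
  case (left a s t u l d)
  then obtain n\<^sub>F1 n1 where "performs r rm F n\<^sub>F1 s n\<^sub>F'" "coupled n\<^sub>F1 n\<^sub>G n1"
    and H: "performs r rm H n [(l, (a, d))] n1"
    using visible_simulation by blast
  then obtain n' where "performs r rm H n1 u n'"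
    using left by blast
  then show ?case
    using performs_append[OF H, of u n'] unfolding append_Cons append_Nil by blast
next
  case (right a s t u l d)
  then obtain n\<^sub>G1 n1 where "performs r rm G n\<^sub>G1 t n\<^sub>G'" "coupled n\<^sub>F n\<^sub>G1 n1"
    and H: "performs r rm H n [(l, (a, d))] n1"
    using net_composition.visible_simulation[OF swap] unfolding coupled_swap by blast
  then obtain n' where "performs r rm H n1 u n'"
    using right by blast
  then show ?case
    using performs_append[OF H, of u n'] unfolding append_Cons append_Nil by blast
next
  case (sync a s t u l d)
  obtain n\<^sub>F1 n\<^sub>F2 where F: "performs r rm F n\<^sub>F [] n\<^sub>F1" "net_step r rm F n\<^sub>F1 (Some (l, (a, d))) n\<^sub>F2"
    "performs r rm F n\<^sub>F2 s n\<^sub>F'"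
    using performs_Cons_split sync.prems by blast
  obtain n\<^sub>G1 n\<^sub>G2 where G: "performs r rm G n\<^sub>G [] n\<^sub>G1"
    "net_step r rm G n\<^sub>G1 (Some (pol_dual l, (\<rho> a, d))) n\<^sub>G2" "performs r rm G n\<^sub>G2 t n\<^sub>G'"
    using performs_Cons_split sync.prems by blast
  obtain n1 where n1: "performs r rm H n [] n1" "coupled n\<^sub>F1 n\<^sub>G n1"
    using silent_simulation[OF F(1)] sync.prems by blast
  obtain n2 where n2: "performs r rm H n1 [] n2" "coupled n\<^sub>F1 n\<^sub>G1 n2"
    using net_composition.silent_simulation[OF swap G(1)] n1(2) unfolding coupled_swap by blast
  have "coupled n\<^sub>F2 n\<^sub>G2 n2"
  proof (cases l)
    case Pro
    then show ?thesis
      using coupled_sync_step[OF n2(2) sync.hyps(1)] F(2) G(2) by simp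
  next
    \<comment> \<open>Here \<open>G\<close> outputs at \<open>\<rho> a\<close> and \<open>F\<close>
      inputs at \<open>\<rho>' (\<rho> a) = a\<close>, so the mirrored lemma applies.\<close>
    case Opp
    then show ?thesis
      using net_composition.coupled_sync_step[OF swap, of n\<^sub>G1 n\<^sub>F1 n2 "\<rho> a" d n\<^sub>G2 n\<^sub>F2]
        \<rho>[OF sync.hyps(1)] n2(2) F(2) G(2) unfolding coupled_swap by simp
  qed
  then obtain n' where "performs r rm H n2 u n'"
    using sync.IH F(3) G(3) by blast
  then show ?case
    using performs_append[OF n1(1) performs_append[OF n2(1), of u n']]
    unfolding append_Nil by blast
qed

section \<open>From a run of the composite to runs of the components\<close>

definition jointly :: "net_config \<Rightarrow> net_config \<Rightarrow> trace \<Rightarrow> bool" where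
  "jointly n\<^sub>F n\<^sub>G u \<longleftrightarrow> (\<exists>s t n\<^sub>F' n\<^sub>G'. performs r rm F n\<^sub>F s n\<^sub>F' \<and> performs r rm G n\<^sub>G t n\<^sub>G' \<and>
     synchronised X Y \<rho> s t u)"

lemma jointly_swap: "net_composition.jointly r rm G F Y X \<rho>' n\<^sub>G n\<^sub>F u \<longleftrightarrow> jointly n\<^sub>F n\<^sub>G u"
proof -
  have "synchronised Y X \<rho>' t s u \<longleftrightarrow> synchronised X Y \<rho> s t u" for s t
    using synchronised_swap[of X Y \<rho> s t u \<rho>'] synchronised_swap[of Y X \<rho>' t s u \<rho>] \<rho> \<rho>' by blast
  then show ?thesis
    unfolding jointly_def net_composition.jointly_def[OF swap] by blast
qed

lemma jointly_stop: "jointly n\<^sub>F n\<^sub>G []"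
  unfolding jointly_def by (blast intro: performs.stop synchronised.nil)

lemma jointly_silent: "net_step r rm F n\<^sub>F None n\<^sub>F' \<Longrightarrow> jointly n\<^sub>F' n\<^sub>G u \<Longrightarrow> jointly n\<^sub>F n\<^sub>G u"
  unfolding jointly_def by (blast intro: performs.silent)

lemma jointly_visible:
  "net_step r rm F n\<^sub>F (Some (l, (a, d))) n\<^sub>F' \<Longrightarrow> a \<notin> X \<Longrightarrow> jointly n\<^sub>F' n\<^sub>G u \<Longrightarrow>
    jointly n\<^sub>F n\<^sub>G ((l, (a, d)) # u)"
  unfolding jointly_def by (blast intro: performs.observable synchronised.left)

text \<open>The handover prolongs both hidden-side traces by matching messages and leaves the
  visible trace as it is.\<close>

lemma jointly_sync:
  assumes "net_step r rm F n\<^sub>F (Some (Pro, (a, d))) n\<^sub>F'"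
    "net_step r rm G n\<^sub>G (Some (Opp, (\<rho> a, d))) n\<^sub>G'" "a \<in> X" "jointly n\<^sub>F' n\<^sub>G' u"
  shows "jointly n\<^sub>F n\<^sub>G u"
proof -
  obtain s t n\<^sub>F'' n\<^sub>G'' where "performs r rm F n\<^sub>F' s n\<^sub>F''" "performs r rm G n\<^sub>G' t n\<^sub>G''"
    "synchronised X Y \<rho> s t u"
    using assms(4) unfolding jointly_def by blast
  then show ?thesis
    using performs.observable[OF assms(1)] performs.observable[OF assms(2)]
      synchronised.sync[OF assms(3), of Y \<rho> s t u Pro d]
    unfolding jointly_def pol_dual.simps by blast
qed

text \<open>The termination measure for handing over hidden messages.\<close>

definition hidden :: "net_config \<Rightarrow> net_config \<Rightarrow> nat" where
  "hidden n\<^sub>F n\<^sub>G = size {#(a, d) \<in># snd n\<^sub>F. a \<in> X#} + size {#(a, d) \<in># snd n\<^sub>G. a \<in> Y#}"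

lemma hidden_swap: "net_composition.hidden Y X n\<^sub>G n\<^sub>F = hidden n\<^sub>F n\<^sub>G"
  unfolding hidden_def net_composition.hidden_def[OF swap] by simp

text \<open>The measure drops because the message leaves a hidden port of \<open>F\<close> and
  arrives at a port of \<open>G\<close> that is not hidden.\<close>

lemma obtain_sync:
  assumes "coupled n\<^sub>F n\<^sub>G n" "(a, d) \<in># snd n\<^sub>F" "a \<in> X"
  shows "\<exists>n\<^sub>F' n\<^sub>G'. coupled n\<^sub>F' n\<^sub>G' n \<and> hidden n\<^sub>F' n\<^sub>G' < hidden n\<^sub>F n\<^sub>G \<and>
    (\<forall>u. jointly n\<^sub>F' n\<^sub>G' u \<longrightarrow> jointly n\<^sub>F n\<^sub>G u)"
proof -
  obtain k\<^sub>F m\<^sub>F k\<^sub>G m\<^sub>G where n: "n\<^sub>F = (k\<^sub>F, add_mset (a, d) m\<^sub>F)" "n\<^sub>G = (k\<^sub>G, m\<^sub>G)"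
    using assms(2) by (metis multi_member_split prod.collapse)
  note sync = coupled_sync[OF assms(1)[unfolded n] assms(3)]
  have "hidden (k\<^sub>F, m\<^sub>F) (k\<^sub>G, add_mset (conn G (\<rho> a), d) m\<^sub>G) < hidden n\<^sub>F n\<^sub>G"
    using sync(3) assms(3) by (simp add: hidden_def n)
  then show ?thesis
    using sync jointly_sync[OF sync(1,2) assms(3)] unfolding n by blast
qed

text \<open>Handovers keep the configuration of \<open>H\<close> fixed, so the components can be
  replaced by flushed ones coupled to the same \<open>n\<close> before the next step of
  \<open>H\<close> is considered.\<close>

lemma jointly_if_flushed:
  assumes "coupled n\<^sub>F n\<^sub>G n"
    and "\<And>n\<^sub>F n\<^sub>G. coupled n\<^sub>F n\<^sub>G n \<Longrightarrow> \<forall>(a, d) \<in># snd n\<^sub>F. a \<notin> X \<Longrightarrow>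
      \<forall>(a, d) \<in># snd n\<^sub>G. a \<notin> Y \<Longrightarrow> jointly n\<^sub>F n\<^sub>G u"
  shows "jointly n\<^sub>F n\<^sub>G u"
  using assms(1)
proof (induction "hidden n\<^sub>F n\<^sub>G" arbitrary: n\<^sub>F n\<^sub>G rule: less_induct)
  case less
  consider a d where "(a, d) \<in># snd n\<^sub>F" "a \<in> X" | a d where "(a, d) \<in># snd n\<^sub>G" "a \<in> Y"
    | "\<forall>(a, d) \<in># snd n\<^sub>F. a \<notin> X" "\<forall>(a, d) \<in># snd n\<^sub>G. a \<notin> Y"
    by blast
  then show ?case
  proof cases
    case 1
    then show ?thesis
      using obtain_sync less by blast
  next
    case 2
    then obtain n\<^sub>F' n\<^sub>G' where "coupled n\<^sub>F' n\<^sub>G' n" "hidden n\<^sub>F' n\<^sub>G' < hidden n\<^sub>F n\<^sub>G"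
      "jointly n\<^sub>F' n\<^sub>G' u \<longrightarrow> jointly n\<^sub>F n\<^sub>G u"
      using net_composition.obtain_sync[OF swap, of n\<^sub>G n\<^sub>F n a d] less.prems
      unfolding coupled_swap hidden_swap jointly_swap by blast
    then show ?thesis
      using less.hyps by blast
  next
    case 3
    then show ?thesis
      using assms(2) less.prems by blast
  qed
qed

lemma step_reflection_cases:
  assumes "coupled n\<^sub>F n\<^sub>G n" "net_step r rm H n l n'"
    and "\<forall>(a, d) \<in># snd n\<^sub>F. a \<notin> X" "\<forall>(a, d) \<in># snd n\<^sub>G. a \<notin> Y"
  obtains n\<^sub>F' where "net_step r rm F n\<^sub>F l n\<^sub>F'" "coupled n\<^sub>F' n\<^sub>G n'"
      "\<And>p a d. l = Some (p, (a, d)) \<Longrightarrow> a \<notin> X"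
  | n\<^sub>G' where "net_step r rm G n\<^sub>G l n\<^sub>G'" "coupled n\<^sub>F n\<^sub>G' n'"
      "\<And>p a d. l = Some (p, (a, d)) \<Longrightarrow> a \<notin> Y"
  using step_cases[OF assms(2)]
proof
  assume "net_step r rm part n l n'"
  then show thesis
    using step_reflection[OF assms(1) _ assms(3,4)] that(1) by blast
next
  assume "net_step r rm (net_composition.part G H Y) n l n'"
  then show thesis
    using net_composition.step_reflection[OF swap, of n\<^sub>G n\<^sub>F n l n'] assms that(2)
    unfolding coupled_swap by blast
qed

text \<open>Before each step of \<open>H\<close> all hidden messages are handed over; then the step
  is reflected in one component, and the other stands still.\<close>

lemma performs_decompose:
  assumes "performs r rm H n u n'" "coupled n\<^sub>F n\<^sub>G n"
  shows "jointly n\<^sub>F n\<^sub>G u"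
  using assms
proof (induction arbitrary: n\<^sub>F n\<^sub>G)
  case (stop n)
  show ?case by (rule jointly_stop)
next
  case (silent n n1 u n2)
  show ?case
  proof (rule jointly_if_flushed[OF silent.prems])
    fix n\<^sub>F n\<^sub>G
    assume flushed: "coupled n\<^sub>F n\<^sub>G n" "\<forall>(a, d) \<in># snd n\<^sub>F. a \<notin> X" "\<forall>(a, d) \<in># snd n\<^sub>G. a \<notin> Y"
    show "jointly n\<^sub>F n\<^sub>G u"
      using flushed(1) silent.hyps(1) flushed(2,3)
    proof (cases rule: step_reflection_cases)
      case (1 n\<^sub>F')
      then show ?thesis
        using jointly_silent[OF 1(1)] silent.IH[OF 1(2)] by blast
    next
      case (2 n\<^sub>G')
      show ?thesis
        using net_composition.jointly_silent[OF swap 2(1), of n\<^sub>F u] silent.IH[OF 2(2)]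
        unfolding jointly_swap by blast
    qed
  qed
next
  case (observable n l n1 u n2)
  obtain p a d where l: "l = (p, (a, d))" by (cases l) auto
  show ?case
  proof (rule jointly_if_flushed[OF observable.prems])
    fix n\<^sub>F n\<^sub>G
    assume flushed: "coupled n\<^sub>F n\<^sub>G n" "\<forall>(a, d) \<in># snd n\<^sub>F. a \<notin> X" "\<forall>(a, d) \<in># snd n\<^sub>G. a \<notin> Y"
    show "jointly n\<^sub>F n\<^sub>G (l # u)"
      using flushed(1) observable.hyps(1) flushed(2,3) unfolding l
    proof (cases rule: step_reflection_cases)
      case (1 n\<^sub>F')
      then show "jointly n\<^sub>F n\<^sub>G ((p, (a, d)) # u)"
        using jointly_visible[OF 1(1)] 1(3) observable.IH[OF 1(2)] by blast
    next
      case (2 n\<^sub>G')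
      then show "jointly n\<^sub>F n\<^sub>G ((p, (a, d)) # u)"
        using net_composition.jointly_visible[OF swap 2(1), of n\<^sub>F u] observable.IH[OF 2(2)]
        unfolding jointly_swap by blast
    qed
  qed
qed

theorem net_traces_composition:
  "net_traces r rm H =
    {u. \<exists>s \<in> net_traces r rm F. \<exists>t \<in> net_traces r rm G. synchronised X Y \<rho> s t u}"
proof (intro set_eqI iffI)
  fix u
  assume "u \<in> net_traces r rm H"
  then show "u \<in> {u. \<exists>s \<in> net_traces r rm F. \<exists>t \<in> net_traces r rm G. synchronised X Y \<rho> s t u}"
    using performs_decompose[OF _ coupled_initial, of u]
    unfolding net_traces_def jointly_def by blast
next
  fix u
  assume "u \<in> {u. \<exists>s \<in> net_traces r rm F. \<exists>t \<in> net_traces r rm G. synchronised X Y \<rho> s t u}"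
  then obtain s t n\<^sub>F n\<^sub>G where "synchronised X Y \<rho> s t u" "performs r rm F initial s n\<^sub>F"
    "performs r rm G initial t n\<^sub>G"
    unfolding net_traces_def by blast
  from performs_compose[OF this coupled_initial] show "u \<in> net_traces r rm H"
    unfolding net_traces_def by blast
qed

end

section \<open>The composite of two morphisms\<close>

lemma in_arrow_iff: "(l, a) \<in> A \<Rrightarrow> B \<longleftrightarrow> (pol_dual l, a) \<in> A \<or> (l, a) \<in> B"
  by (simp add: arrow_def tensor_def dual_iff)

lemma supp_arrow: "supp (A \<Rrightarrow> B) = supp A \<union> supp B"
  by (simp add: arrow_def supp_tensor)

text \<open>These identities translate the case distinctions in \<open>net_comp\<close> into visible
  sources, the form used by the locale.\<close>

lemma sources_arrow:
  assumes "ext S = A \<Rrightarrow> B" "supp A \<inter> supp B = {}" "supp (ext S) \<inter> supp (engine_ifc S) = {}"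
  shows "a \<in> sources S \<and> a \<notin> supp B \<longleftrightarrow> a \<in> supp (opp_ports (dual A) \<otimes> pro_ports (engine_ifc S))"
    and "a \<in> sources S \<and> a \<notin> supp A \<longleftrightarrow> a \<in> supp (opp_ports B \<otimes> pro_ports (engine_ifc S))"
  using assms(2,3)
  by (auto simp: in_sources_iff supp_tensor in_supp_opp_ports_iff in_supp_pro_ports_iff assms(1)
      in_arrow_iff supp_arrow dual_iff disjoint_iff dest: in_suppI)

lemma same_shape_iff:
  assumes "same_shape \<pi> B B'"
  shows "(l, \<pi> a) \<in> B' \<longleftrightarrow> (l, a) \<in> B" "\<pi> a \<in> supp B' \<longleftrightarrow> a \<in> supp B"
proof -
  have "inj \<pi>"
    using assms by (auto simp: same_shape_def bij_def)
  then show "(l, \<pi> a) \<in> B' \<longleftrightarrow> (l, a) \<in> B" for l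
    using assms by (auto simp: same_shape_def inj_eq)
  then show "\<pi> a \<in> supp B' \<longleftrightarrow> a \<in> supp B"
    by (simp add: in_supp_iff)
qed

text \<open>Well-formedness of the composite keeps connections from visible ports from crossing the
  hidden interface twice. The hypotheses together ensure that \<open>f\<close> and \<open>g\<close>
  can share port names only between \<open>B\<close> and \<open>B'\<close>.\<close>

theorem theorem3:
  fixes r rm :: nat and A B B' C :: interface and f g :: net
    and \<pi> :: "port_name \<Rightarrow> port_name"
  assumes "rm \<le> r"
    and "morphism r f A B"
    and "morphism r g B' C"
    and "same_shape \<pi> B B'"
    and "\<forall>a \<in> supp A \<union> supp C. \<pi> a = a"
    and "supp (engine_ifc f) \<inter> supp (engine_ifc g) = {}"
    and "supp (engine_ifc f) \<inter> supp B' = {}"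
    and "supp (engine_ifc g) \<inter> supp B = {}"
    and "morphism r (net_comp \<pi> A B B' C f g) A C"
  shows "net_traces r rm (net_comp \<pi> A B B' C f g) =
         trace_comp rm \<pi> A B C (net_traces r rm f) (net_traces r rm g)"
proof -
  let ?h = "net_comp \<pi> A B B' C f g"
  have f: "wf_net r f" "ext f = A \<Rrightarrow> B" and g: "wf_net r g" "ext g = B' \<Rrightarrow> C"
    and h: "wf_net r ?h" "ext ?h = A \<Rrightarrow> C"
    using assms(2,3,9) by (auto simp: morphism_def)
  have AB: "supp A \<inter> supp B = {}" and B'C: "supp B' \<inter> supp C = {}" and AC: "supp A \<inter> supp C = {}"
    using assms(2,3,9) by (auto simp: morphism_def)
  have supp_ext: "supp (ext f) = supp A \<union> supp B" "supp (ext g) = supp B' \<union> supp C"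
    by (simp_all add: f g supp_arrow)
  have ext_engine: "supp (ext f) \<inter> supp (engine_ifc f) = {}" "supp (ext g) \<inter> supp (engine_ifc g) = {}"
    using f g by (auto simp: wf_net_def)
  have "engine_ifc ?h = engine_ifc f \<union> engine_ifc g"
    by (auto simp: engine_ifc_def net_comp_def)
  moreover have "supp (ext ?h) \<inter> supp (engine_ifc ?h) = {}"
    using h by (simp add: wf_net_def)
  ultimately have h_disj: "(supp A \<union> supp C) \<inter> (supp (engine_ifc f) \<union> supp (engine_ifc g)) = {}"
    unfolding h(2) supp_arrow by (simp add: supp_def image_Un)
  have bij: "bij \<pi>"
    using assms(4) by (simp add: same_shape_def)
  have inv: "inv \<pi> (\<pi> a) = a" "\<pi> (inv \<pi> a) = a" for a
    using bij by (simp_all add: bij_def surj_f_inv_f)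
  note shape = same_shape_iff[OF assms(4)]
  \<comment> \<open>The permutation fixes the names of \<open>A\<close> and \<open>C\<close>, so
    such a name lies in \<open>B'\<close> exactly if it lies in \<open>B\<close>.\<close>
  have AB': "supp A \<inter> supp B' = {}" and BC: "supp B \<inter> supp C = {}"
    using assms(5) shape(2) AB B'C by (metis Un_iff disjoint_iff)+
  have separate: "(port_names f - supp B) \<inter> port_names g = {}"
    "(port_names g - supp B') \<inter> port_names f = {}"
    using assms(6-8) AB AB' AC BC B'C h_disj unfolding port_names_def supp_ext by blast+
  interpret net_composition r rm f g ?h "supp B" "supp B'" \<pi> "inv \<pi>"
  proof
    show "ext ?h = {p \<in> ext f. snd p \<notin> supp B} \<union> {p \<in> ext g. snd p \<notin> supp B'}"
    proof (rule set_eqI)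
      fix p :: "polarity \<times> port_name"
      obtain l a where p: "p = (l, a)" by (cases p)
      show "p \<in> ext ?h \<longleftrightarrow> p \<in> {p \<in> ext f. snd p \<notin> supp B} \<union> {p \<in> ext g. snd p \<notin> supp B'}"
        using AB B'C in_suppI[of "pol_dual l" a A] in_suppI[of l a B] in_suppI[of "pol_dual l" a B']
          in_suppI[of l a C]
        by (simp add: f g h p in_arrow_iff) blast
    qed
    show "conn ?h a = forward (supp B) \<pi> g (conn f a)" if "a \<in> sources f" "a \<notin> supp B" for a
      using that sources_arrow(1)[OF f(2) AB ext_engine(1), of a]
      by (simp add: net_comp_def forward_def)
    show "conn ?h a = forward (supp B') (inv \<pi>) f (conn g a)" if a: "a \<in> sources g" "a \<notin> supp B'" for a
    proof -
      \<comment> \<open>The connection map of \<open>net_comp\<close> tests the sources of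
        \<open>f\<close> first, so the branch for \<open>g\<close> is reached only outside
        them.\<close>
      have "a \<notin> sources f"
        using a separate(2) sources_subset by blast
      then show ?thesis
        using a sources_arrow(1)[OF f(2) AB ext_engine(1), of a]
          sources_arrow(2)[OF g(2) B'C ext_engine(2), of a]
        by (simp add: net_comp_def forward_def)
    qed
    show "(pol_dual l, \<pi> a) \<in> ext g" if "a \<in> supp B" "(l, a) \<in> ext f" for a l
      using that AB shape(1)[of l a]
      by (auto simp: f g in_arrow_iff disjoint_iff dest: in_suppI)
    show "(pol_dual l, inv \<pi> a) \<in> ext f" if "a \<in> supp B'" "(l, a) \<in> ext g" for a l
      using that B'C shape(1)[of "pol_dual l" "inv \<pi> a"]
      by (auto simp: f g inv in_arrow_iff disjoint_iff dest: in_suppI)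
    show "inv \<pi> a \<in> supp B \<and> \<pi> (inv \<pi> a) = a" if "a \<in> supp B'" for a
      using that shape(2)[of "inv \<pi> a"] by (simp add: inv)
  qed (use assms(1) f g h separate shape inv in \<open>simp_all add: net_comp_def supp_arrow\<close>)
  have \<pi>: "\<pi> b \<in> supp B' \<and> \<pi> b \<notin> supp A" if "b \<in> supp B" for b
    using that shape(2) AB' by blast
  have \<pi>_id: "\<pi> a = a" if "a \<in> supp A \<union> supp C" for a
    using that assms(5) by blast
  show ?thesis
  proof (intro set_eqI iffI)
    fix u
    assume "u \<in> net_traces r rm ?h"
    then obtain s t where st: "s \<in> net_traces r rm f" "t \<in> net_traces r rm g"
      and sync: "synchronised (supp B) (supp B') \<pi> s t u"
      unfolding net_traces_composition by blast
    have "s \<in> traces_over rm (ext f)" "t \<in> traces_over rm (ext g)"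
      using st performs_traces_over[OF _ f(1) rm_le valid_initial]
        performs_traces_over[OF _ g(1) rm_le valid_initial]
      unfolding net_traces_def by blast+
    then have "s \<in> traces_over rm (A \<otimes> B)" "t \<in> traces_over rm (B' \<otimes> C)"
      by (simp_all add: traces_over_def supp_ext supp_tensor)
    from synchronised_obtain_trace[OF sync this AB AC BC \<pi> \<pi>_id]
    show "u \<in> trace_comp rm \<pi> A B C (net_traces r rm f) (net_traces r rm g)"
      using st unfolding trace_comp_def by blast
  next
    fix u
    assume "u \<in> trace_comp rm \<pi> A B C (net_traces r rm f) (net_traces r rm g)"
    then show "u \<in> net_traces r rm ?h"
      using synchronised_traces[OF _ AB AC BC \<pi> \<pi>_id B'C]
      unfolding trace_comp_def net_traces_composition by blast
  qed
qed

end
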